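(* Let $p,q$ be real numbers. The double inequality $$pD(a,b)+(1-p)H(a,b)<Q(a,b)<qD(a,b)+(1-q)H(a,b)$$ holds for all $a,b>0$ with $a\neq b$ if and only if $p\leq 1/2$ and $q\geq \sqrt{2}/2$.
   Context: For real $a,b>0$ with $a\neq b$: $H(a,b)=\dfrac{2ab}{a+b}$ is the harmonic mean, $Q(a,b)=\sqrt{\dfrac{a^2+b^2}{2}}$ is the quadratic mean, and $D(a,b)=\dfrac{a^3+b^3}{a^2+b^2}$ is the second contraharmonic mean. *)

theory Defs
  imports Complex_Main
begin

definition harmonic_mean :: "real \<Rightarrow> real \<Rightarrow> real" where
  "harmonic_mean a b = 2 * a * b / (a + b)"

definition quadratic_mean :: "real \<Rightarrow> real \<Rightarrow> real" where
  "quadratic_mean a b = sqrt ((a\<^sup>2 + b\<^sup>2) / 2)"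

definition second_contraharmonic_mean :: "real \<Rightarrow> real \<Rightarrow> real" where
  "second_contraharmonic_mean a b = (a ^ 3 + b ^ 3) / (a\<^sup>2 + b\<^sup>2)"

end

theory Submission
  imports Defs
begin

text \<open>
  Write \<open>H\<close>, \<open>Q\<close>, \<open>D\<close> for the harmonic, quadratic and second contraharmonic means of \<open>a, b\<close>,
  \<open>A = (a + b) / 2\<close> and \<open>u = Q / A\<close>, which for \<open>a \<noteq> b\<close> lies strictly between \<open>1\<close> and
  \<open>sqrt 2\<close>. Since \<open>a b = 2 A\<^sup>2 - Q\<^sup>2\<close>, the three means are \<open>A\<close> times rational functions of \<open>u\<close>,
  and after cancelling the common factor \<open>u - 1\<close> one finds
  \<open>(Q - H) / (D - H) = u\<^sup>2 (u + 2) / ((u + 1) (u\<^sup>2 + 2))\<close>, with \<open>D > H\<close>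
  (\<open>mean_difference_ratio\<close>). The double inequality thus says that this ratio lies strictly
  between \<open>p\<close> and \<open>q\<close>.

  On \<open>1 < u < sqrt 2\<close> the ratio lies strictly between its values \<open>1 / 2\<close> and \<open>sqrt 2 / 2\<close> at the
  end points (\<open>mean_ratio_bounds\<close>), which gives sufficiency. Every \<open>u\<close> in this open interval
  arises from some pair \<open>a, b\<close> (\<open>quadratic_arithmetic_quotient_attained\<close>), so letting \<open>u\<close> tend to
  \<open>1\<close> and to \<open>sqrt 2\<close> gives necessity.
\<close>

text \<open>The value of \<open>(Q - H) / (D - H)\<close> as a function of \<open>u = 2 Q / (a + b)\<close>.\<close>

definition mean_ratio :: "real \<Rightarrow> real" where
  "mean_ratio u = u\<^sup>2 * (u + 2) / ((u + 1) * (u\<^sup>2 + 2))"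

lemma mean_ratio_endpoints:
  "mean_ratio 1 = 1 / 2" "mean_ratio (sqrt 2) = sqrt 2 / 2"
proof -
  show "mean_ratio 1 = 1 / 2"
    by (simp add: mean_ratio_def)
  have "sqrt 2 + 1 > (0::real)"
    by (simp add: add_pos_pos)
  then show "mean_ratio (sqrt 2) = sqrt 2 / 2"
    by (simp add: mean_ratio_def field_simps)
qed

lemma isCont_mean_ratio:
  assumes "u > 0"
  shows "isCont mean_ratio u"
proof -
  have "(u + 1) * (u\<^sup>2 + 2) > 0"
    using assms by (simp add: add_pos_pos)
  then show ?thesis
    unfolding mean_ratio_def by (intro continuous_intros) auto
qed

lemma mean_ratio_bounds:
  assumes "1 < u" "u < sqrt 2"
  shows "1 / 2 < mean_ratio u" "mean_ratio u < sqrt 2 / 2"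
proof -
  have pos: "(u + 1) * (u\<^sup>2 + 2) > 0"
    using assms by (simp add: add_pos_pos)
  have "0 < (u - 1) * (u\<^sup>2 + 4 * u + 2)"
    using assms by (intro mult_pos_pos add_pos_pos) auto
  also have "\<dots> = 2 * (u\<^sup>2 * (u + 2)) - (u + 1) * (u\<^sup>2 + 2)"
    by (simp add: algebra_simps power2_eq_square)
  finally show "1 / 2 < mean_ratio u"
    using pos by (simp add: mean_ratio_def pos_less_divide_eq)
  define s where "s = sqrt (2::real)"
  have s: "s * s = 2" "s < 2" "0 < s"
    using real_sqrt_less_mono[of 2 4] by (auto simp: s_def)
  \<comment> \<open>The cubic \<open>s / 2 * (u + 1) * (u\<^sup>2 + 2) - u\<^sup>2 * (u + 2)\<close> has the root \<open>u = s\<close>; it agrees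
    with the factored form only modulo \<open>s\<^sup>2 = 2\<close>.\<close>
  have "0 < (s - u) * ((1 - s / 2) * u\<^sup>2 + (1 + s / 2) * u + 1)"
    using assms s by (intro mult_pos_pos add_pos_pos) (auto simp: s_def)
  also have "\<dots> = s / 2 * ((u + 1) * (u\<^sup>2 + 2)) - u\<^sup>2 * (u + 2) + (s * s - 2) * (u - u\<^sup>2) / 2"
    by (simp add: field_simps power2_eq_square)
  also have "\<dots> = s / 2 * ((u + 1) * (u\<^sup>2 + 2)) - u\<^sup>2 * (u + 2)"
    by (simp add: s(1))
  finally show "mean_ratio u < sqrt 2 / 2"
    using pos by (simp add: mean_ratio_def pos_divide_less_eq s_def)
qed

lemma quadratic_mean_less:
  assumes "0 < a" "0 < b" "a \<noteq> b"
  defines "A \<equiv> (a + b) / 2"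
  shows "A < quadratic_mean a b" "quadratic_mean a b < sqrt 2 * A"
proof -
  have "0 < (a - b)\<^sup>2"
    using assms(3) by simp
  then show "A < quadratic_mean a b"
    unfolding quadratic_mean_def A_def
    by (intro real_less_rsqrt) (simp add: power2_eq_square field_simps)
  have "sqrt ((a\<^sup>2 + b\<^sup>2) / 2) < sqrt (2 * A\<^sup>2)"
    using assms(1,2) mult_pos_pos[of a b]
    by (intro real_sqrt_less_mono) (simp add: A_def power2_eq_square field_simps)
  then show "quadratic_mean a b < sqrt 2 * A"
    using assms(1,2) by (simp add: quadratic_mean_def real_sqrt_mult A_def)
qed

lemma mean_difference_ratio:
  assumes "0 < a" "0 < b" "a \<noteq> b"
  defines "u \<equiv> 2 * quadratic_mean a b / (a + b)"
  shows "1 < u" "u < sqrt 2"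
    and "harmonic_mean a b < second_contraharmonic_mean a b"
    and "quadratic_mean a b - harmonic_mean a b =
           mean_ratio u * (second_contraharmonic_mean a b - harmonic_mean a b)"
proof -
  define A where "A = (a + b) / 2"
  have A: "A > 0"
    using assms by (simp add: A_def)
  have Q: "quadratic_mean a b = A * u"
    using assms by (simp add: A_def u_def)
  show u: "1 < u" "u < sqrt 2"
    using quadratic_mean_less[OF assms(1-3)] A
    by (simp_all add: Q flip: A_def)
  have sq: "a\<^sup>2 + b\<^sup>2 = 2 * (A * u)\<^sup>2"
    unfolding Q[symmetric] by (simp add: quadratic_mean_def)
  have sum: "a + b = 2 * A"
    by (simp add: A_def)
  have "2 * (a * b) = (a + b)\<^sup>2 - (a\<^sup>2 + b\<^sup>2)"
    by (simp add: power2_sum)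
  then have ab: "a * b = A\<^sup>2 * (2 - u\<^sup>2)"
    unfolding sq sum by (simp add: algebra_simps power_mult_distrib)
  have H: "harmonic_mean a b = A * (2 - u\<^sup>2)"
    using A ab by (simp add: harmonic_mean_def sum mult.assoc power2_eq_square)
  have "a ^ 3 + b ^ 3 = (a + b) * (a\<^sup>2 + b\<^sup>2 - a * b)"
    by (simp add: algebra_simps power2_eq_square power3_eq_cube)
  also have "\<dots> = 2 * A ^ 3 * (3 * u\<^sup>2 - 2)"
    unfolding sq sum ab by (simp add: algebra_simps power2_eq_square power3_eq_cube)
  finally have cubes: "a ^ 3 + b ^ 3 = 2 * A ^ 3 * (3 * u\<^sup>2 - 2)" .
  have D: "second_contraharmonic_mean a b = A * (3 * u\<^sup>2 - 2) / u\<^sup>2"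
    unfolding second_contraharmonic_mean_def cubes sq
    using A u by (simp add: field_simps power2_eq_square power3_eq_cube)
  have DH: "second_contraharmonic_mean a b - harmonic_mean a b =
              A * (u - 1) * ((u + 1) * (u\<^sup>2 + 2)) / u\<^sup>2"
    unfolding D H using u by (simp add: field_simps power2_eq_square)
  have pos: "(u + 1) * (u\<^sup>2 + 2) > 0"
    using u by (simp add: add_pos_pos)
  have "A * (u - 1) * ((u + 1) * (u\<^sup>2 + 2)) / u\<^sup>2 > 0"
    using A u pos by (intro divide_pos_pos mult_pos_pos[OF _ pos]) auto
  then show "harmonic_mean a b < second_contraharmonic_mean a b"
    unfolding DH[symmetric] by simp
  have "mean_ratio u * (second_contraharmonic_mean a b - harmonic_mean a b) =
          A * (u - 1) * (u + 2)"
    unfolding DH mean_ratio_def using u zero_less_mult_pos[OF pos] by simp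
  also have "\<dots> = quadratic_mean a b - harmonic_mean a b"
    unfolding Q H by (simp add: algebra_simps power2_eq_square)
  finally show "quadratic_mean a b - harmonic_mean a b =
      mean_ratio u * (second_contraharmonic_mean a b - harmonic_mean a b)" ..
qed

lemma quadratic_mean_between_iff:
  assumes "0 < a" "0 < b" "a \<noteq> b"
  defines "u \<equiv> 2 * quadratic_mean a b / (a + b)"
  shows "p * second_contraharmonic_mean a b + (1 - p) * harmonic_mean a b < quadratic_mean a b \<and>
         quadratic_mean a b < q * second_contraharmonic_mean a b + (1 - q) * harmonic_mean a b
         \<longleftrightarrow> p < mean_ratio u \<and> mean_ratio u < q"
proof -
  define d where "d = second_contraharmonic_mean a b - harmonic_mean a b"
  have d: "d > 0" and eq: "quadratic_mean a b = harmonic_mean a b + mean_ratio u * d"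
    using mean_difference_ratio(3,4)[OF assms(1-3)] by (simp_all add: d_def u_def)
  have "r * second_contraharmonic_mean a b + (1 - r) * harmonic_mean a b =
          harmonic_mean a b + r * d" for r
    by (simp add: d_def algebra_simps)
  then show ?thesis
    using d by (simp add: eq)
qed

lemma quadratic_arithmetic_quotient_attained:
  assumes "1 < u" "u < sqrt 2"
  shows "\<exists>a b. 0 < a \<and> 0 < b \<and> a \<noteq> b \<and> 2 * quadratic_mean a b / (a + b) = u"
proof -
  \<comment> \<open>For a pair \<open>1 + v, 1 - v\<close> the squared quotient is \<open>1 + v\<^sup>2\<close>.\<close>
  define v where "v = sqrt (u\<^sup>2 - 1)"
  have "u\<^sup>2 > 1"
    using assms by (simp add: one_less_power)
  moreover have "u\<^sup>2 < 2"
    using assms power_strict_mono[of u "sqrt 2" 2] by simp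
  ultimately have v: "0 < v" "v < 1" "v\<^sup>2 = u\<^sup>2 - 1"
    by (simp_all add: v_def)
  have "((1 + v)\<^sup>2 + (1 - v)\<^sup>2) / 2 = u\<^sup>2"
    using v(3) by (simp add: power2_eq_square algebra_simps)
  then have "quadratic_mean (1 + v) (1 - v) = u"
    using assms by (simp add: quadratic_mean_def)
  then show ?thesis
    using v by (intro exI[of _ "1 + v"] exI[of _ "1 - v"]) auto
qed

theorem theorem3p2:
  fixes p q :: real
  shows "(\<forall>a b :: real. 0 < a \<and> 0 < b \<and> a \<noteq> b \<longrightarrow>
            p * second_contraharmonic_mean a b + (1 - p) * harmonic_mean a b < quadratic_mean a b \<and>
            quadratic_mean a b < q * second_contraharmonic_mean a b + (1 - q) * harmonic_mean a b)
         \<longleftrightarrow> p \<le> 1 / 2 \<and> q \<ge> sqrt 2 / 2"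
    (is "?L \<longleftrightarrow> ?R")
proof
  assume ?L
  then have bounds: "p < mean_ratio u \<and> mean_ratio u < q" if "1 < u" "u < sqrt 2" for u
    using quadratic_arithmetic_quotient_attained[OF that] quadratic_mean_between_iff by blast
  have "(mean_ratio \<longlongrightarrow> mean_ratio 1) (at_right 1)"
    using isCont_mean_ratio[of 1] by (simp add: isCont_def filterlim_at_split)
  moreover have "\<forall>\<^sub>F u in at_right 1. p \<le> mean_ratio u"
    by (rule eventually_mono[OF eventually_at_right_real[of 1 "sqrt 2"]])
      (use bounds in \<open>auto intro: less_imp_le\<close>)
  ultimately have "p \<le> mean_ratio 1"
    by (rule tendsto_lowerbound) simp
  moreover have "(mean_ratio \<longlongrightarrow> mean_ratio (sqrt 2)) (at_left (sqrt 2))"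
    using isCont_mean_ratio[of "sqrt 2"] by (simp add: isCont_def filterlim_at_split)
  moreover have "\<forall>\<^sub>F u in at_left (sqrt 2). mean_ratio u \<le> q"
    by (rule eventually_mono[OF eventually_at_left_real[of 1 "sqrt 2"]])
      (use bounds in \<open>auto intro: less_imp_le\<close>)
  ultimately show ?R
    using tendsto_upperbound[of mean_ratio "mean_ratio (sqrt 2)" "at_left (sqrt 2)" q]
    by (simp add: mean_ratio_endpoints)
next
  assume R: ?R
  show ?L
  proof (intro allI impI)
    fix a b :: real
    assume ab: "0 < a \<and> 0 < b \<and> a \<noteq> b"
    define u where "u = 2 * quadratic_mean a b / (a + b)"
    have "1 < u" "u < sqrt 2"
      using mean_difference_ratio(1,2) ab by (auto simp: u_def)
    then have "p < mean_ratio u \<and> mean_ratio u < q"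
      using mean_ratio_bounds[of u] R by simp
    then show "p * second_contraharmonic_mean a b + (1 - p) * harmonic_mean a b < quadratic_mean a b \<and>
        quadratic_mean a b < q * second_contraharmonic_mean a b + (1 - q) * harmonic_mean a b"
      using quadratic_mean_between_iff ab unfolding u_def by blast
  qed
qed

end
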